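(* For any Serra connectivity lattice $(L,\mathcal{C})$, the set $\mathcal{C}$ contains all absolutely connected elements of $L$. Furthermore, a subset $\mathcal{C}$ of a complete lattice $L$ is an absolute connectivity in $L$ if and only if $\mathcal{C}$ is the set of all absolutely connected elements in $L$ and every element of $L$ is a join of absolutely connected elements.
   Context: Let $L$ be a complete lattice with bottom $0$ and $L^+=L\setminus\{0\}$ with the induced order. In a poset $P$, a mail is a non-empty subset having a common lower bound in $P$; a subset $M$ of $P$ is mail-connected if $M\neq\varnothing$ and for any $x,y\in M$ there is a sequence $s_1,\dots,s_n\in M$ with $s_1=x$, $s_n=y$ and each $\{s_i,s_{i+1}\}$ a mail in $P$. A subset $S$ of $P$ (possibly empty) is totally mail-disconnected in $P$ if no two distinct elements of $S$ have a common lower bound in $P$. $\mathcal{D}(P)$ is the poset of totally mail-disconnected subsets of $P$, with $D_1\leqslant D_2$ iff each element of $D_1$ is below some element of $D_2$. An element $a\in L$ is absolutely connected if for every totally mail-disconnected subset $S$ of $L^+$ (including $S=\varnothing$), $a\leqslant\bigvee S$ implies $a\leqslant s$ for some $s\in S$. A pair $(L,\mathcal{C})$, with $\mathcal{C}\subseteq L$, is a Serra connectivity lattice if: $0\notin\mathcal{C}$; the join of every non-empty subset $X\subseteq\mathcal{C}$ that has a lower bound in $L$ different from $0$ belongs to $\mathcal{C}$; and every element of $L$ is a join of elements from $\mathcal{C}$. $\mathcal{C}\subseteq L$ is a connectivity in $L$ if for every $M\subseteq\mathcal{C}$ that is mail-connected in the poset $\mathcal{C}$ (with induced order), the join of $M$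 in $L$ belongs to $\mathcal{C}$. In this case the map $\mathcal{D}(\mathcal{C})\to L$, $S\mapsto\bigvee S$ is left Galois adjoint to $x\mapsto\mathcal{C}(x)$, where $\mathcal{C}(x)$ is the set of maximal elements of $\{c\in\mathcal{C}\mid c\leqslant x\}$; this is the connectivity adjunction. $\mathcal{C}$ is an absolute connectivity in $L$ if it is a connectivity in $L$ and its connectivity adjunction is an isomorphism of posets. *)

theory Defs
  imports Main
begin

text \<open>
  A poset \<open>P\<close> is a subset of a type of class \<^class>\<open>order\<close>, with the induced order.  The complete
  lattice \<open>L\<close> is the universe of a type of class \<^class>\<open>complete_lattice\<close>, so that \<open>L\<^sup>+\<close> is the
  subset \<open>- {bot}\<close>.
\<close>

definition mail :: "'a::order set \<Rightarrow> 'a set \<Rightarrow> bool" where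
  "mail P M \<longleftrightarrow> M \<subseteq> P \<and> M \<noteq> {} \<and> (\<exists>l\<in>P. \<forall>m\<in>M. l \<le> m)"

definition mail_connected :: "'a::order set \<Rightarrow> 'a set \<Rightarrow> bool" where
  "mail_connected P M \<longleftrightarrow> M \<subseteq> P \<and> M \<noteq> {} \<and>
     (\<forall>x\<in>M. \<forall>y\<in>M. \<exists>(s :: nat \<Rightarrow> 'a) n. 1 \<le> n \<and> s 1 = x \<and> s n = y \<and>
        (\<forall>i\<in>{1..n}. s i \<in> M) \<and> (\<forall>i\<in>{1..<n}. mail P {s i, s (Suc i)}))"

definition totally_mail_disconnected :: "'a::order set \<Rightarrow> 'a set \<Rightarrow> bool" where
  "totally_mail_disconnected P S \<longleftrightarrow> S \<subseteq> P \<and>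
     (\<forall>x\<in>S. \<forall>y\<in>S. x \<noteq> y \<longrightarrow> \<not> (\<exists>l\<in>P. l \<le> x \<and> l \<le> y))"

definition tmd_sets :: "'a::order set \<Rightarrow> 'a set set" where
  "tmd_sets P = {S. totally_mail_disconnected P S}"

definition tmd_le :: "'a::order set \<Rightarrow> 'a set \<Rightarrow> bool" where
  "tmd_le D1 D2 \<longleftrightarrow> (\<forall>d1\<in>D1. \<exists>d2\<in>D2. d1 \<le> d2)"

definition absolutely_connected :: "'a::complete_lattice \<Rightarrow> bool" where
  "absolutely_connected a \<longleftrightarrow>
     (\<forall>S. totally_mail_disconnected (- {bot}) S \<longrightarrow> a \<le> Sup S \<longrightarrow> (\<exists>s\<in>S. a \<le> s))"

definition Serra_connectivity_lattice :: "'a::complete_lattice set \<Rightarrow> bool" where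
  "Serra_connectivity_lattice C \<longleftrightarrow>
     bot \<notin> C \<and>
     (\<forall>X\<subseteq>C. X \<noteq> {} \<and> (\<exists>l. l \<noteq> bot \<and> (\<forall>x\<in>X. l \<le> x)) \<longrightarrow> Sup X \<in> C) \<and>
     (\<forall>x. \<exists>X\<subseteq>C. x = Sup X)"

definition connectivity :: "'a::complete_lattice set \<Rightarrow> bool" where
  "connectivity C \<longleftrightarrow> (\<forall>M\<subseteq>C. mail_connected C M \<longrightarrow> Sup M \<in> C)"

definition components :: "'a::order set \<Rightarrow> 'a \<Rightarrow> 'a set" where
  "components C x = {c \<in> C. c \<le> x \<and> (\<forall>d\<in>C. d \<le> x \<longrightarrow> c \<le> d \<longrightarrow> d = c)}"

definition poset_isomorphism ::
  "'a set \<Rightarrow> ('a \<Rightarrow> 'a \<Rightarrow> bool) \<Rightarrow> 'b set \<Rightarrow> ('b \<Rightarrow> 'b \<Rightarrow> bool) \<Rightarrow> ('a \<Rightarrow> 'b) \<Rightarrow> ('b \<Rightarrow> 'a) \<Rightarrow> bool"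
  where
  "poset_isomorphism A leA B leB f g \<longleftrightarrow>
     f ` A \<subseteq> B \<and> g ` B \<subseteq> A \<and>
     monotone_on A leA leB f \<and> monotone_on B leB leA g \<and>
     (\<forall>x\<in>A. g (f x) = x) \<and> (\<forall>y\<in>B. f (g y) = y)"

text \<open>
  The left and right adjoint of the connectivity adjunction are \<open>Sup\<close> and \<open>components C\<close>
  (see \<open>connectivity_adjunction\<close> below); the adjunction is an isomorphism when these two maps are
  mutually inverse order-preserving maps.
\<close>

definition absolute_connectivity :: "'a::complete_lattice set \<Rightarrow> bool" where
  "absolute_connectivity C \<longleftrightarrow> connectivity C \<and>
     poset_isomorphism (tmd_sets C) tmd_le UNIV (\<le>) Sup (components C)"

lemma mail_connectedI:
  assumes "M \<subseteq> P" "c \<in> M" "\<And>m. m \<in> M \<Longrightarrow> c \<le> m"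
  shows "mail_connected P M"
  unfolding mail_connected_def
proof (intro conjI ballI)
  show "M \<subseteq> P" "M \<noteq> {}" using assms by auto
next
  fix x y assume xy: "x \<in> M" "y \<in> M"
  let ?s = "\<lambda>i::nat. if i = 1 then x else if i = 2 then c else y"
  have "mail P {x, c}" "mail P {c, y}"
    using assms xy unfolding mail_def by auto
  then have "\<forall>i\<in>{1..<3}. mail P {?s i, ?s (Suc i)}"
    by (auto simp: less_Suc_eq numeral_3_eq_3)
  moreover have "\<forall>i\<in>{1..3}. ?s i \<in> M" using assms xy by auto
  ultimately show "\<exists>(s :: nat \<Rightarrow> 'a) n. 1 \<le> n \<and> s 1 = x \<and> s n = y \<and>
        (\<forall>i\<in>{1..n}. s i \<in> M) \<and> (\<forall>i\<in>{1..<n}. mail P {s i, s (Suc i)})"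
    by (intro exI[of _ ?s] exI[of _ 3]) auto
qed

lemma connectivity_Sup_up_set:
  assumes "connectivity C" "M \<subseteq> C" "c \<in> M" "\<And>m. m \<in> M \<Longrightarrow> c \<le> m"
  shows "Sup M \<in> C"
  using assms mail_connectedI[of M C c] unfolding connectivity_def by blast

lemma ex_component:
  assumes "connectivity C" "c \<in> C" "c \<le> x"
  shows "\<exists>m\<in>components C x. c \<le> m"
proof -
  let ?M = "{d \<in> C. c \<le> d \<and> d \<le> x}"
  have *: "Sup ?M \<in> C"
    using assms by (intro connectivity_Sup_up_set[of C ?M c]) auto
  have "Sup ?M \<le> x" by (auto intro: Sup_least)
  moreover have c: "c \<le> Sup ?M" using assms by (auto intro: Sup_upper)
  moreover have "d = Sup ?M" if "d \<in> C" "d \<le> x" "Sup ?M \<le> d" for d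
    using that c by (intro antisym Sup_upper) auto
  ultimately show ?thesis using * unfolding components_def by blast
qed

lemma components_in_tmd_sets:
  assumes "connectivity C"
  shows "components C x \<in> tmd_sets C"
proof -
  have "c = d" if cd: "c \<in> components C x" "d \<in> components C x"
    and l: "l \<in> C" "l \<le> c" "l \<le> d" for c d l
  proof -
    have "Sup {l, c, d} \<in> C"
      using assms cd l by (intro connectivity_Sup_up_set[of C _ l]) (auto simp: components_def)
    moreover have "Sup {l, c, d} \<le> x"
      using cd l by (intro Sup_least) (auto simp: components_def)
    moreover have "c \<le> Sup {l, c, d}" "d \<le> Sup {l, c, d}"
      by (rule Sup_upper, simp)+
    ultimately have "Sup {l, c, d} = c" "Sup {l, c, d} = d"
      using cd by (simp_all only: components_def mem_Collect_eq)
    then show "c = d" by (rule subst)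
  qed
  then show ?thesis
    unfolding tmd_sets_def totally_mail_disconnected_def by (auto simp: components_def)
qed

lemma connectivity_adjunction:
  assumes "connectivity C" "S \<in> tmd_sets C"
  shows "Sup S \<le> x \<longleftrightarrow> tmd_le S (components C x)"
proof
  assume "Sup S \<le> x"
  then have "s \<in> C \<and> s \<le> x" if "s \<in> S" for s
    using assms(2) that
    by (auto simp: tmd_sets_def totally_mail_disconnected_def Sup_le_iff)
  then show "tmd_le S (components C x)"
    using ex_component[OF assms(1)] unfolding tmd_le_def by blast
next
  assume "tmd_le S (components C x)"
  then show "Sup S \<le> x"
    unfolding tmd_le_def components_def by (auto intro!: Sup_least intro: order_trans)
qed

end

theory Submission
  imports Defs
begin

text \<open>
  If every element is a join of elements of a connectivity \<open>C\<close> with \<open>bot \<notin> C\<close>, then every non-zero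
  element has an element of \<open>C\<close> below it, so total mail-disconnectedness in \<open>C\<close> and in \<open>L\<^sup>+\<close> agree
  for subsets of \<open>C\<close>, and every \<open>x\<close> is the join of its totally mail-disconnected set of components.
  An absolutely connected \<open>x\<close> is then below, hence equal to, one of its components.  If moreover
  \<open>Sup\<close> and \<open>components C\<close> are mutually inverse, the components of the join of a totally
  mail-disconnected \<open>S\<close> are the components of the members of \<open>S\<close>, so that elements of \<open>C\<close> are
  absolutely connected.
\<close>

text \<open>Induction on the position in a chain from \<open>x\<close> to \<open>y\<close> replaces
  explicit chains by a single step between members with a common lower bound \<open>l\<close> in
  \<open>P\<close>.\<close>

lemma mail_connected_induct [consumes 3, case_names base step]:
  assumes "mail_connected P M" "x \<in> M" "y \<in> M"
    and base: "Q x"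
    and step: "\<And>u v l. u \<in> M \<Longrightarrow> v \<in> M \<Longrightarrow> l \<in> P \<Longrightarrow> l \<le> u \<Longrightarrow> l \<le> v \<Longrightarrow> Q u \<Longrightarrow> Q v"
  shows "Q y"
proof -
  have "\<exists>(s :: nat \<Rightarrow> 'a) n. 1 \<le> n \<and> s 1 = x \<and> s n = y \<and>
      (\<forall>i\<in>{1..n}. s i \<in> M) \<and> (\<forall>i\<in>{1..<n}. mail P {s i, s (Suc i)})"
    using assms(1-3) unfolding mail_connected_def by simp
  then obtain s :: "nat \<Rightarrow> 'a" and n where n: "1 \<le> n" and s: "s 1 = x" "s n = y" "\<forall>i\<in>{1..n}. s i \<in> M"
    "\<forall>i\<in>{1..<n}. mail P {s i, s (Suc i)}"
    by (elim exE conjE)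
  \<comment> \<open>The chain is controlled only at positions 1 to \<open>n\<close>, hence the guard
    \<open>i \<le> n\<close> and an induction starting at 1.\<close>
  have "i \<le> n \<longrightarrow> Q (s i)" if "1 \<le> i" for i
    using that
  proof (induction i rule: dec_induct)
    case base
    then show ?case using s(1) \<open>Q x\<close> by simp
  next
    case (step i)
    show ?case
    proof
      assume i: "Suc i \<le> n"
      then obtain l where "l \<in> P" "l \<le> s i" "l \<le> s (Suc i)"
        using s(4) step.hyps unfolding mail_def by force
      then show "Q (s (Suc i))"
        using assms(5)[of "s i" "s (Suc i)" l] s(3) step i by simp
    qed
  qed
  then show ?thesis using n s(2) by auto
qed

lemma Sup_components:
  assumes "connectivity C" "X \<subseteq> C" "x = Sup X"
  shows "Sup (components C x) = x"
proof (rule antisym)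
  show "Sup (components C x) \<le> x" by (rule Sup_least) (simp add: components_def)
  have "\<exists>m\<in>components C x. c \<le> m" if "c \<in> X" for c
    using assms that by (intro ex_component) (auto intro: Sup_upper)
  then show "x \<le> Sup (components C x)"
    unfolding assms(3) by (rule Sup_mono)
qed

lemma ex_generator_le:
  fixes x :: "'a::complete_lattice"
  assumes "\<forall>x. \<exists>X\<subseteq>C. x = Sup X" "x \<noteq> bot"
  shows "\<exists>c\<in>C. c \<le> x"
proof -
  obtain X where X: "X \<subseteq> C" "x = Sup X" using assms(1) by blast
  then have "X \<noteq> {}" using assms(2) by auto
  then show ?thesis using X by (auto intro: Sup_upper)
qed

lemma totally_mail_disconnected_generators:
  fixes C :: "'a::complete_lattice set"
  assumes "bot \<notin> C" "\<forall>x. \<exists>X\<subseteq>C. x = Sup X" "totally_mail_disconnected C S"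
  shows "totally_mail_disconnected (- {bot}) S"
  unfolding totally_mail_disconnected_def
proof (intro conjI ballI impI notI)
  show "S \<subseteq> - {bot}" using assms unfolding totally_mail_disconnected_def by auto
next
  fix x y assume xy: "x \<in> S" "y \<in> S" "x \<noteq> y" and "\<exists>l\<in>- {bot}. l \<le> x \<and> l \<le> y"
  then obtain l where l: "l \<noteq> bot" "l \<le> x" "l \<le> y" by auto
  obtain c where "c \<in> C" "c \<le> l" using ex_generator_le[OF assms(2) l(1)] by blast
  then show False
    using assms(3) xy l unfolding totally_mail_disconnected_def by (meson order_trans)
qed

text \<open>The empty set has join \<open>bot\<close> but no member. Consequently, lower bounds
  taken among absolutely connected elements are non-zero.\<close>

lemma not_absolutely_connected_bot: "\<not> absolutely_connected bot"
  unfolding absolutely_connected_def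
  by (auto intro!: exI[of _ "{}"] simp: totally_mail_disconnected_def)

text \<open>The Serra axiom joins families with one common non-zero lower bound, while neighbours in
  a mail-connected \<open>M\<close> share merely pairwise ones. The remedy is to fix
  \<open>x\<close> in \<open>M\<close> and collect the elements of \<open>C\<close> between
  \<open>x\<close> and \<open>Sup M\<close>: they have \<open>x\<close> as a lower bound, and along
  chains every member of \<open>M\<close> falls below one of them.\<close>

lemma Serra_imp_connectivity:
  assumes "Serra_connectivity_lattice C"
  shows "connectivity C"
  unfolding connectivity_def
proof (intro allI impI)
  have bot: "bot \<notin> C"
    using assms unfolding Serra_connectivity_lattice_def by simp
  have join: "Sup X \<in> C" if "X \<subseteq> C" "X \<noteq> {}" "l \<noteq> bot" "\<And>x. x \<in> X \<Longrightarrow> l \<le> x" for X l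
    using assms that unfolding Serra_connectivity_lattice_def by meson
  fix M assume M: "M \<subseteq> C" "mail_connected C M"
  then obtain x where x: "x \<in> M" unfolding mail_connected_def by auto
  let ?T = "{t \<in> C. x \<le> t \<and> t \<le> Sup M}"
  have T: "\<exists>t\<in>?T. y \<le> t" if "y \<in> M" for y
    using M(2) x that
  proof (induction rule: mail_connected_induct)
    case base
    have "x \<in> ?T" using subsetD[OF M(1) x] Sup_upper[OF x] by simp
    then show ?case by (intro bexI[of _ x]) simp_all
  next
    case (step u v l)
    from step.IH obtain t where t: "t \<in> C" "x \<le> t" "t \<le> Sup M" "u \<le> t" by blast
    have "l \<noteq> bot" using step.hyps(3) bot by blast
    moreover have "l \<le> t" using step.hyps(4) t(4) by (rule order_trans)
    \<comment> \<open>\<open>l\<close> is a non-zero lower bound of both \<open>t\<close> and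
      \<open>v\<close>, so the Serra axiom lets \<open>t\<close> absorb \<open>v\<close>.\<close>
    ultimately have "Sup {t, v} \<in> C"
      using t(1) step.hyps(2,5) M(1) by (intro join[of _ l]) auto
    moreover have "Sup {t, v} \<le> Sup M"
      using t(3) Sup_upper[OF step.hyps(2)] by simp
    moreover have "x \<le> Sup {t, v}"
      using t(2) by (simp add: le_supI1)
    moreover have "v \<le> Sup {t, v}" by simp
    ultimately show ?case by blast
  qed
  have "Sup ?T \<in> C"
    using T[OF x] x M bot by (intro join[of _ x]) auto
  moreover have "Sup ?T = Sup M"
    using T by (intro antisym Sup_least Sup_mono) auto
  ultimately show "Sup M \<in> C" by simp
qed

lemma absolutely_connected_in_Serra:
  assumes "Serra_connectivity_lattice C" "absolutely_connected a"
  shows "a \<in> C"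
proof -
  have conn: "connectivity C" by (rule Serra_imp_connectivity[OF assms(1)])
  have bot: "bot \<notin> C" and gen: "\<forall>x. \<exists>X\<subseteq>C. x = Sup X"
    using assms(1) unfolding Serra_connectivity_lattice_def by blast+
  have "totally_mail_disconnected (- {bot}) (components C a)"
    using totally_mail_disconnected_generators[OF bot gen] components_in_tmd_sets[OF conn]
    unfolding tmd_sets_def by blast
  moreover have "Sup (components C a) = a"
    using gen Sup_components[OF conn] by metis
  ultimately obtain c where "c \<in> components C a" "a \<le> c"
    using assms(2) unfolding absolutely_connected_def by auto
  then show ?thesis unfolding components_def by (auto dest: antisym)
qed

text \<open>Each member of \<open>M\<close> lies below some member of \<open>S\<close>; neighbours
  in a chain share a non-zero lower bound, so disconnectedness of \<open>S\<close> forces the same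
  member for all of \<open>M\<close>.\<close>

lemma connectivity_absolutely_connected: "connectivity {a. absolutely_connected a}"
  unfolding connectivity_def
proof (intro allI impI, rule CollectI)
  fix M :: "'a set"
  assume M: "M \<subseteq> {a. absolutely_connected a}" "mail_connected {a. absolutely_connected a} M"
  then obtain x where x: "x \<in> M" unfolding mail_connected_def by auto
  show "absolutely_connected (Sup M)"
    unfolding absolutely_connected_def
  proof (intro allI impI)
    fix S :: "'a set"
    assume S: "totally_mail_disconnected (- {bot}) S" "Sup M \<le> Sup S"
    have below: "\<exists>s\<in>S. m \<le> s" if "m \<in> M" for m
      using M S that unfolding absolutely_connected_def by (auto simp: Sup_le_iff)
    obtain s where s: "s \<in> S" "x \<le> s" using below[OF x] by blast
    have "m \<le> s" if "m \<in> M" for m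
      using M(2) x that
    proof (induction rule: mail_connected_induct)
      case base
      show ?case by (rule s)
    next
      case (step u v l)
      obtain s' where s': "s' \<in> S" "v \<le> s'" using below step by blast
      have "l \<noteq> bot" using step not_absolutely_connected_bot by auto
      moreover have "l \<le> s" "l \<le> s'" using step s' by (meson order_trans)+
      ultimately have "s' = s"
        using S(1) s s' unfolding totally_mail_disconnected_def by blast
      then show ?case using s' by simp
    qed
    then show "\<exists>s\<in>S. Sup M \<le> s" using s by (blast intro: Sup_least)
  qed
qed

text \<open>From left to right, \<open>C\<close> is shown to satisfy the Serra axioms, which gives
  one inclusion. From right to left, the components of \<open>Sup S\<close> are recovered as
  \<open>S\<close>, because an element of \<open>C\<close> below \<open>Sup S\<close> is already
  below a member of \<open>S\<close>.\<close>

lemma absolute_connectivity_iff_absolutely_connected: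
  fixes C :: "'a::complete_lattice set"
  shows "absolute_connectivity C \<longleftrightarrow>
    C = {a. absolutely_connected a} \<and> (\<forall>x :: 'a. \<exists>X \<subseteq> {a. absolutely_connected a}. x = Sup X)"
proof
  assume "absolute_connectivity C"
  then have conn: "connectivity C"
    and inv: "\<And>S. S \<in> tmd_sets C \<Longrightarrow> components C (Sup S) = S"
    and Sup_comp: "\<And>x. Sup (components C x) = x"
    unfolding absolute_connectivity_def poset_isomorphism_def by auto
  have comp_sub: "components C x \<subseteq> C" for x unfolding components_def by auto
  have gen: "\<forall>x. \<exists>X\<subseteq>C. x = Sup X" using comp_sub Sup_comp by metis
  \<comment> \<open>\<open>{}\<close> is totally mail-disconnected with join \<open>bot\<close>; if
    \<open>bot\<close> were in \<open>C\<close>, it would lie below a component of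
    \<open>bot\<close>.\<close>
  have "components C bot = {}"
    using inv[of "{}"] by (simp add: tmd_sets_def totally_mail_disconnected_def)
  then have bot: "bot \<notin> C" using ex_component[OF conn, of bot bot] by auto
  have "Sup X \<in> C" if X: "X \<subseteq> C" "X \<noteq> {}" and l: "l \<noteq> bot" "\<forall>x\<in>X. l \<le> x" for X l
  proof -
    obtain c where c: "c \<in> C" "c \<le> l" using ex_generator_le[OF gen l(1)] by blast
    have c_le: "c \<le> x" if "x \<in> X" for x using c l that by (meson order_trans)
    then have "c \<le> Sup X" using X(2) by (meson Sup_upper2 ex_in_conv)
    \<comment> \<open>Adjoining \<open>c\<close> leaves the join unchanged but supplies a least
      member, which makes the set mail-connected in \<open>C\<close>.\<close>
    then have "Sup (insert c X) = Sup X" by (simp add: sup_absorb2)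
    moreover have "Sup (insert c X) \<in> C"
      using c X c_le by (intro connectivity_Sup_up_set[OF conn, of _ c]) auto
    ultimately show ?thesis by simp
  qed
  then have "Serra_connectivity_lattice C"
    using bot gen unfolding Serra_connectivity_lattice_def by blast
  then have sub: "{a. absolutely_connected a} \<subseteq> C"
    using absolutely_connected_in_Serra by blast
  have "absolutely_connected c" if c: "c \<in> C" for c
    unfolding absolutely_connected_def
  proof (intro allI impI)
    fix S assume S: "totally_mail_disconnected (- {bot}) S" "c \<le> Sup S"
    \<comment> \<open>Members of \<open>S\<close> may lie outside \<open>C\<close>, where
      \<open>inv\<close> does not apply; replacing each by its components keeps the join and stays
      inside \<open>C\<close>.\<close>
    let ?T = "\<Union>s\<in>S. components C s"
    have "t = u" if tu: "s \<in> S" "t \<in> components C s" "s' \<in> S" "u \<in> components C s'"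
      and l: "l \<in> C" "l \<le> t" "l \<le> u" for s t s' u l
    proof -
      \<comment> \<open>The non-zero \<open>l\<close> first identifies \<open>s\<close> with
        \<open>s'\<close>; two components of one element with a common lower bound in
        \<open>C\<close> then coincide.\<close>
      have "l \<le> s" "l \<le> s'" using tu l unfolding components_def by auto
      then have "s = s'"
        using S(1) tu l bot unfolding totally_mail_disconnected_def by blast
      then show ?thesis
        using components_in_tmd_sets[OF conn, of s] tu l
        unfolding tmd_sets_def totally_mail_disconnected_def by blast
    qed
    then have "?T \<in> tmd_sets C"
      using comp_sub unfolding tmd_sets_def totally_mail_disconnected_def by blast
    then have "components C (Sup ?T) = ?T" by (rule inv)
    moreover have "Sup ?T = Sup S"
    proof (rule antisym)
      show "Sup ?T \<le> Sup S"
        unfolding components_def by (rule Sup_mono) auto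
      have "s \<le> Sup ?T" if "s \<in> S" for s
        using Sup_subset_mono[of "components C s" ?T] that Sup_comp[of s] by auto
      then show "Sup S \<le> Sup ?T" by (rule Sup_least)
    qed
    ultimately obtain t where "t \<in> ?T" "c \<le> t"
      using ex_component[OF conn c S(2)] by auto
    then show "\<exists>s\<in>S. c \<le> s" unfolding components_def by (auto intro: order_trans)
  qed
  then have "C = {a. absolutely_connected a}" using sub by blast
  then show "C = {a. absolutely_connected a} \<and>
      (\<forall>x :: 'a. \<exists>X \<subseteq> {a. absolutely_connected a}. x = Sup X)"
    using gen by simp
next
  assume asm: "C = {a. absolutely_connected a} \<and>
      (\<forall>x :: 'a. \<exists>X \<subseteq> {a. absolutely_connected a}. x = Sup X)"
  then have C: "C = {a. absolutely_connected a}" and gen: "\<forall>x. \<exists>X\<subseteq>C. x = Sup X" by simp_all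
  have conn: "connectivity C" unfolding C by (rule connectivity_absolutely_connected)
  have bot: "bot \<notin> C" using not_absolutely_connected_bot C by simp
  have Sup_comp: "Sup (components C x) = x" for x
    using gen Sup_components[OF conn] by metis
  have inv: "components C (Sup S) = S" if S: "S \<in> tmd_sets C" for S
  proof -
    have tmd: "totally_mail_disconnected C S" using S unfolding tmd_sets_def by simp
    have SC: "S \<subseteq> C" using tmd unfolding totally_mail_disconnected_def by simp
    have below: "\<exists>s\<in>S. c \<le> s" if "c \<in> C" "c \<le> Sup S" for c
      using that totally_mail_disconnected_generators[OF bot gen tmd] C
      unfolding absolutely_connected_def by blast
    show ?thesis
    proof (intro equalityI subsetI)
      fix c assume c: "c \<in> components C (Sup S)"
      then obtain s where s: "s \<in> S" "c \<le> s"
        using below unfolding components_def by blast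
      then have "s = c" using c SC Sup_upper[OF s(1)] unfolding components_def by auto
      then show "c \<in> S" using s by simp
    next
      fix s assume s: "s \<in> S"
      have "d = s" if d: "d \<in> C" "d \<le> Sup S" "s \<le> d" for d
      proof -
        obtain s' where s': "s' \<in> S" "d \<le> s'" using below d by blast
        \<comment> \<open>\<open>s\<close> itself is a common lower bound of \<open>s\<close> and
          \<open>s'\<close> in \<open>C\<close>, so the two coincide.\<close>
        have "s \<le> s'" using s' d by simp
        then have "s' = s" using tmd s s' SC unfolding totally_mail_disconnected_def by blast
        then show ?thesis using s' d by simp
      qed
      then show "s \<in> components C (Sup S)"
        using s SC Sup_upper[OF s] unfolding components_def by auto
    qed
  qed
  have "monotone_on (tmd_sets C) tmd_le (\<le>) Sup"
    unfolding tmd_le_def by (auto intro!: monotone_onI Sup_mono)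
  \<comment> \<open>For \<open>x \<le> y\<close>, the join of \<open>components C x\<close> is
    \<open>x\<close> and so lies below \<open>y\<close>, which the adjunction turns into
    \<open>tmd_le\<close>.\<close>
  moreover have "monotone_on UNIV (\<le>) tmd_le (components C)"
    using connectivity_adjunction[OF conn components_in_tmd_sets[OF conn]] Sup_comp
    by (auto intro!: monotone_onI)
  ultimately show "absolute_connectivity C"
    using conn inv Sup_comp components_in_tmd_sets[OF conn]
    unfolding absolute_connectivity_def poset_isomorphism_def by auto
qed

theorem theorem52:
  "(\<forall>C :: 'a::complete_lattice set.
      Serra_connectivity_lattice C \<longrightarrow> {a. absolutely_connected a} \<subseteq> C) \<and>
   (\<forall>C :: 'a set.
      absolute_connectivity C \<longleftrightarrow>
        C = {a. absolutely_connected a} \<and>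
        (\<forall>x :: 'a. \<exists>X \<subseteq> {a. absolutely_connected a}. x = Sup X))"
proof (rule conjI)
  show "\<forall>C :: 'a set. Serra_connectivity_lattice C \<longrightarrow> {a. absolutely_connected a} \<subseteq> C"
    using absolutely_connected_in_Serra by blast
  show "\<forall>C :: 'a set. absolute_connectivity C \<longleftrightarrow> C = {a. absolutely_connected a} \<and>
      (\<forall>x :: 'a. \<exists>X \<subseteq> {a. absolutely_connected a}. x = Sup X)"
    by (rule allI, rule absolute_connectivity_iff_absolutely_connected)
qed

end
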